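(* Let $n\ge 1$ be an integer and let $\mathbf{B}^n=\{x\in\mathbf{R}^n:\|x\|\le 1\}$ be the closed unit ball. Let $\gamma\colon[0,\infty)\to\mathbf{R}^n$ be any path (in the sense defined in the context), and let $\ell\colon[0,\infty)\to\mathbf{R}^n$ be a straight line path, $\ell(s)=su$ for a fixed unit vector $u\in\mathbf{R}^n$. Let $X$ be a random variable uniformly distributed in $\mathbf{B}^n$. Then \[ J(\gamma)\ge J(\ell), \] where for a path $\eta$ we set $J(\eta)=\mathbb{E}[T_\eta(X)]$ and $T_\eta(x)=\inf\{t\ge 0: x+\eta(t)\notin\operatorname{int}(\mathbf{B}^n)\}$ (with $\inf\emptyset=\infty$).
   Context: $\|\cdot\|$ is the Euclidean norm. A path is a continuous curve $\gamma\colon[0,\infty)\to\mathbf{R}^n$ with $\gamma(0)=0$ that is arc-length parametrised: for every $t>0$, the length of the curve from $\gamma(0)$ to $\gamma(t)$ is exactly $t$ (corners are allowed). The escape time $T_\gamma(x)$ from a starting point $x\in\mathbf{B}^n$ is the first time $t\ge0$ at which $x+\gamma(t)$ leaves the interior of the unit ball, defined to be $\infty$ if this never happens. The expected escape time is $J(\gamma)=\mathbb{E}[T_\gamma(X)]$ with $X$ uniform in $\mathbf{B}^n$. *)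

theory Defs
  imports "HOL-Analysis.Analysis"
begin

definition curve_length :: "(real \<Rightarrow> 'a::real_normed_vector) \<Rightarrow> real \<Rightarrow> real \<Rightarrow> ennreal" where
  "curve_length g a b =
     (SUP ts \<in> {ts. sorted ts \<and> set ts \<subseteq> {a..b}}.
        ennreal (\<Sum>i<length ts - 1. norm (g (ts ! Suc i) - g (ts ! i))))"

definition arc_path :: "(real \<Rightarrow> 'a::real_normed_vector) \<Rightarrow> bool" where
  "arc_path g \<longleftrightarrow> continuous_on {0..} g \<and> g 0 = 0 \<and>
     (\<forall>t>0. curve_length g 0 t = ennreal t)"

text \<open>Escape time from the open unit ball (infimum of the empty set is \<infinity>).\<close>
definition escape_time :: "(real \<Rightarrow> 'a::real_normed_vector) \<Rightarrow> 'a \<Rightarrow> ennreal" where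
  "escape_time g x = (INF t \<in> {t. 0 \<le> t \<and> x + g t \<notin> ball 0 1}. ennreal t)"

definition expected_escape :: "(real \<Rightarrow> 'a::euclidean_space) \<Rightarrow> ennreal" where
  "expected_escape g = (\<integral>\<^sup>+ x. escape_time g x \<partial>(uniform_measure lborel (cball 0 1)))"

end

theory Submission
  imports Defs
begin

text \<open>
  The expected escape time is the integral over \<open>t\<close> of the normalised volume of the set of points
  surviving up to time \<open>t\<close>, and these volumes can be compared for each \<open>t < 2\<close> separately
  (for larger \<open>t\<close> the line has no survivors).
  The survivors form the intersection of the unit balls centred at \<open>-\<gamma>(s)\<close>, \<open>0 \<le> s \<le> t\<close>.
  Reparametrise the curve of centres from its midpoint, \<open>p(s)\<close> with \<open>\<bar>s\<bar> \<le> L = t/2\<close>, and shrink the ball at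
  \<open>p(s)\<close> to radius \<open>sqrt (c + s\<^sup>2)\<close>, where \<open>c = 1 - L\<^sup>2\<close>; for the line this does not change the intersection.
  Going outwards from \<open>ball (p 0) (sqrt c)\<close>, the volume lost between two consecutive balls depends only on the
  distance of their centres and increases with it (by reflection in a bisecting hyperplane), so
  each loss is at most the corresponding loss for the line, where the lost sets are pairwise disjoint.
\<close>

subsection \<open>Reflections and differences of balls\<close>

lemma emeasure_lborel_translate:
  fixes a :: "'a::euclidean_space"
  assumes "A \<in> sets borel"
  shows "emeasure lborel {x. a + x \<in> A} = emeasure lborel A"
proof -
  have "emeasure lborel A = emeasure (distr lborel borel ((+) a)) A"
    by (simp add: lborel_distr_plus)
  also have "\<dots> = emeasure lborel {x. a + x \<in> A}"
    using assms by (subst emeasure_distr) (auto simp: vimage_def)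
  finally show ?thesis by simp
qed

lemma nn_integral_lborel_translate:
  fixes a :: "'a::euclidean_space" and h :: "'a \<Rightarrow> ennreal"
  assumes [measurable]: "h \<in> borel_measurable borel"
  shows "(\<integral>\<^sup>+x. h (a + x) \<partial>lborel) = (\<integral>\<^sup>+x. h x \<partial>lborel)"
proof -
  have "(\<integral>\<^sup>+x. h x \<partial>lborel) = (\<integral>\<^sup>+x. h x \<partial>distr lborel borel ((+) a))"
    by (simp add: lborel_distr_plus)
  also have "\<dots> = (\<integral>\<^sup>+x. h (a + x) \<partial>lborel)"
    by (subst nn_integral_distr) auto
  finally show ?thesis by simp
qed

text \<open>Uniqueness of Haar measure by Fubini: translation invariance turns
  \<open>vol {x. f x \<in> A} * vol B\<close> into \<open>vol A * vol B\<close>, where \<open>B\<close> is the unit ball, which \<open>f\<close> preserves.\<close>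
lemma emeasure_lborel_linear_isometric_involution:
  fixes f :: "'a::euclidean_space \<Rightarrow> 'a"
  assumes lin: "linear f" and iso: "\<And>x. norm (f x) = norm x" and inv: "\<And>x. f (f x) = x"
    and A[measurable]: "A \<in> sets borel"
  shows "emeasure lborel {x. f x \<in> A} = emeasure lborel A"
proof -
  define B where "B = (ball 0 1 :: 'a set)"
  have [measurable]: "B \<in> sets borel" by (simp add: B_def)
  have [measurable]: "f \<in> borel_measurable borel"
    using lin by (intro borel_measurable_continuous_onI linear_continuous_on) (simp add: linear_linear)
  have sub: "f x - f y = f (x - y)" for x y using lin by (simp add: linear_diff)
  have add: "f x + f y = f (x + y)" for x y using lin by (simp add: linear_add)
  have "emeasure lborel {x. f x \<in> A} * emeasure lborel B
      = (\<integral>\<^sup>+y. indicator B y * (\<integral>\<^sup>+x. indicator A (f x) \<partial>lborel) \<partial>lborel)"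
  proof -
    have "(\<integral>\<^sup>+x. indicator A (f x) \<partial>lborel) = (\<integral>\<^sup>+x. indicator {x. f x \<in> A} x \<partial>lborel)"
      by (intro nn_integral_cong) (auto simp: indicator_def)
    then show ?thesis by (simp add: nn_integral_multc mult.commute)
  qed
  also have "\<dots> = (\<integral>\<^sup>+y. (\<integral>\<^sup>+x. indicator B y * indicator A (f x + y) \<partial>lborel) \<partial>lborel)"
  proof (rule nn_integral_cong)
    fix y
    \<comment> \<open>Shifting \<open>x\<close> by \<open>f y\<close> turns \<open>f x\<close> into
      \<open>f x + y\<close>, because \<open>f\<close> is a linear involution.\<close>
    have "(\<integral>\<^sup>+x. indicator A (f x) \<partial>lborel) = (\<integral>\<^sup>+x. indicator A (f (f y + x)) \<partial>lborel :: ennreal)"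
      by (rule nn_integral_lborel_translate[symmetric]) measurable
    also have "\<dots> = (\<integral>\<^sup>+x. indicator A (f x + y) \<partial>lborel)"
      by (simp add: linear_add[OF lin] inv add.commute)
    finally show "indicator B y * (\<integral>\<^sup>+x. indicator A (f x) \<partial>lborel)
      = (\<integral>\<^sup>+x. indicator B y * indicator A (f x + y) \<partial>lborel)"
      by (simp add: nn_integral_cmult)
  qed
  also have "\<dots> = (\<integral>\<^sup>+x. (\<integral>\<^sup>+y. indicator B y * indicator A (f x + y) \<partial>lborel) \<partial>lborel)"
    using lborel_pair.Fubini[of "\<lambda>(x, y). indicator B y * indicator A (f x + y)"] by simp
  also have "\<dots> = (\<integral>\<^sup>+x. (\<integral>\<^sup>+y. indicator B (y - f x) * indicator A y \<partial>lborel) \<partial>lborel)"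
  proof (rule nn_integral_cong)
    fix x
    have "(\<integral>\<^sup>+y. indicator B (y - f x) * indicator A y \<partial>lborel :: ennreal)
      = (\<integral>\<^sup>+y. indicator B (f x + y - f x) * indicator A (f x + y) \<partial>lborel)"
      by (rule nn_integral_lborel_translate[symmetric, of "\<lambda>y. indicator B (y - f x) * indicator A y"]) measurable
    then show "(\<integral>\<^sup>+y. indicator B y * indicator A (f x + y) \<partial>lborel :: ennreal)
      = (\<integral>\<^sup>+y. indicator B (y - f x) * indicator A y \<partial>lborel)"
      by simp
  qed
  also have "\<dots> = (\<integral>\<^sup>+y. (\<integral>\<^sup>+x. indicator B (y - f x) * indicator A y \<partial>lborel) \<partial>lborel)"
    using lborel_pair.Fubini[of "\<lambda>(x, y). indicator B (y - f x) * indicator A y"] by simp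
  also have "\<dots> = (\<integral>\<^sup>+y. emeasure lborel B * indicator A y \<partial>lborel)"
  proof (rule nn_integral_cong)
    fix y
    \<comment> \<open>An isometric involution carries the condition on \<open>f x\<close> back to
      \<open>x\<close>: the admissible \<open>x\<close> form the unit ball about
      \<open>f y\<close>.\<close>
    have "norm (f x - y) = norm (f y - x)" for x
      using iso[of "y - f x"] by (simp add: linear_diff[OF lin] inv norm_minus_commute)
    then have "(\<integral>\<^sup>+x. indicator B (y - f x) \<partial>lborel) = (\<integral>\<^sup>+x. indicator (ball (f y) 1) x \<partial>lborel :: ennreal)"
      by (intro nn_integral_cong) (auto simp: indicator_def B_def dist_norm norm_minus_commute)
    also have "\<dots> = emeasure lborel B"
      using emeasure_lborel_translate[of "ball (f y) 1" "f y"]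
      by (simp add: B_def ball_def dist_norm)
    finally show "(\<integral>\<^sup>+x. indicator B (y - f x) * indicator A y \<partial>lborel) = emeasure lborel B * indicator A y"
      by (simp add: nn_integral_multc)
  qed
  also have "\<dots> = emeasure lborel A * emeasure lborel B"
    by (subst nn_integral_cmult_indicator) (auto simp: mult.commute)
  finally have *: "emeasure lborel {x. f x \<in> A} * emeasure lborel B = emeasure lborel A * emeasure lborel B" .
  have "emeasure lborel B \<noteq> 0" "emeasure lborel B \<noteq> top"
    using emeasure_lborel_ball_finite[of "0::'a" 1] content_ball_pos[of 1 "0::'a"]
    by (auto simp: B_def measure_def less_top)
  with * show ?thesis
    by (simp add: mult.commute[of _ "emeasure lborel B"] ennreal_mult_cancel_left)
qed

text \<open>Orthogonal reflection in the hyperplane equidistant from \<open>p\<close> and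
  \<open>q\<close>. For \<open>p = q\<close> the subtracted vector vanishes and the map is the
  identity.\<close>

definition bisector_reflection :: "'a::real_inner \<Rightarrow> 'a \<Rightarrow> 'a \<Rightarrow> 'a" where
  "bisector_reflection p q x =
     x - (2 * ((x - midpoint p q) \<bullet> (q - p)) / ((q - p) \<bullet> (q - p))) *\<^sub>R (q - p)"

text \<open>Conjugating with the translation by the midpoint leaves a linear reflection, which is an
  isometric involution.\<close>

lemma emeasure_bisector_reflection:
  fixes p q :: "'a::euclidean_space"
  assumes A[measurable]: "A \<in> sets borel"
  shows "emeasure lborel {x. bisector_reflection p q x \<in> A} = emeasure lborel A"
proof -
  define n where "n = q - p"
  define m where "m = midpoint p q"
  define f where "f x = x - (2 * (x \<bullet> n) / (n \<bullet> n)) *\<^sub>R n" for x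
  have lin: "linear f"
    by (rule linearI) (auto simp: f_def inner_add_left algebra_simps add_divide_distrib)
  have inv: "f (f x) = x" for x
    by (cases "n = 0") (auto simp: f_def inner_diff_left algebra_simps)
  have "norm (f x) ^ 2 = norm x ^ 2" for x
    unfolding power2_norm_eq_inner
    by (cases "n = 0") (auto simp: f_def inner_diff_left inner_diff_right algebra_simps inner_commute)
  then have iso: "norm (f x) = norm x" for x
    by (simp add: power2_eq_iff_nonneg)
  have eq: "bisector_reflection p q x = m + f (x - m)" for x
    by (simp add: bisector_reflection_def f_def n_def m_def)
  have [measurable]: "f \<in> borel_measurable borel"
    using lin by (intro borel_measurable_continuous_onI linear_continuous_on) (simp add: linear_linear)
  have "emeasure lborel {x. m + f (x - m) \<in> A} = emeasure lborel {x. m + f x \<in> A}"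
    by (subst emeasure_lborel_translate[symmetric, of _ m]) auto
  also have "\<dots> = emeasure lborel {x. m + x \<in> A}"
    using emeasure_lborel_linear_isometric_involution[OF lin iso inv, of "{x. m + x \<in> A}"] by simp
  also have "\<dots> = emeasure lborel A" by (rule emeasure_lborel_translate) simp
  finally show ?thesis by (simp add: eq)
qed

text \<open>The difference of the squared distances to \<open>p\<close> and \<open>q\<close> is
  affine in the point and measures on which side of the bisector it lies. The correction term is
  thus positive when \<open>x\<close> and \<open>z\<close> are strictly on the same side, and
  negative when they are strictly on opposite sides.\<close>

lemma dist_bisector_reflection:
  assumes "p \<noteq> q"
  shows "(dist z (bisector_reflection p q x))\<^sup>2 = (dist z x)\<^sup>2
    + ((dist x p)\<^sup>2 - (dist x q)\<^sup>2) * ((dist z p)\<^sup>2 - (dist z q)\<^sup>2) / (dist p q)\<^sup>2"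
proof -
  define d m where "d = q - p" and "m = midpoint p q"
  define a where "a = 2 * ((x - m) \<bullet> d) / (d \<bullet> d)"
  have eq: "2 * ((y - m) \<bullet> d) = (dist y p)\<^sup>2 - (dist y q)\<^sup>2" for y
    unfolding dist_norm power2_norm_eq_inner m_def midpoint_def d_def
    by (simp add: inner_diff_left inner_diff_right inner_add_left inner_add_right inner_commute algebra_simps)
  have "d \<bullet> d = (dist p q)\<^sup>2" "d \<bullet> d \<noteq> 0"
    using assms by (auto simp: d_def dist_norm power2_norm_eq_inner[symmetric] norm_minus_commute)
  have ad: "a * (d \<bullet> d) = 2 * ((x - m) \<bullet> d)"
    using \<open>d \<bullet> d \<noteq> 0\<close> by (simp add: a_def)
  have "bisector_reflection p q x = x - a *\<^sub>R d"
    by (simp add: bisector_reflection_def a_def d_def m_def)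
  then have "z - bisector_reflection p q x = z - x + a *\<^sub>R d" by (simp only: diff_diff_eq2 algebra_simps)
  then have "(dist z (bisector_reflection p q x))\<^sup>2 = (norm (z - x + a *\<^sub>R d))\<^sup>2"
    by (simp only: dist_norm)
  also have "\<dots> = (dist z x)\<^sup>2 + 2 * a * ((z - x) \<bullet> d) + a * (a * (d \<bullet> d))"
    unfolding dist_norm power2_norm_eq_inner
    by (simp add: inner_add_left inner_add_right inner_commute algebra_simps)
  also have "\<dots> = (dist z x)\<^sup>2 + a * (2 * ((z - m) \<bullet> d))"
    unfolding ad by (simp add: inner_diff_left algebra_simps)
  also have "a = ((dist x p)\<^sup>2 - (dist x q)\<^sup>2) / (dist p q)\<^sup>2"
    using eq[of x] \<open>d \<bullet> d = (dist p q)\<^sup>2\<close> by (simp add: a_def)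
  finally show ?thesis by (simp add: eq)
qed

lemma dist_bisector_reflection_swap:
  assumes "p \<noteq> q"
  shows "dist p (bisector_reflection p q x) = dist q x" "dist q (bisector_reflection p q x) = dist p x"
proof -
  have "(dist p (bisector_reflection p q x))\<^sup>2 = (dist q x)\<^sup>2"
    "(dist q (bisector_reflection p q x))\<^sup>2 = (dist p x)\<^sup>2"
    using assms by (simp_all add: dist_bisector_reflection dist_commute field_simps)
  then show "dist p (bisector_reflection p q x) = dist q x" "dist q (bisector_reflection p q x) = dist p x"
    by (simp_all add: power2_eq_iff_nonneg)
qed

text \<open>The correction term is at most 0: \<open>z\<close> is on the side of \<open>p\<close>
  and \<open>x\<close> on that of \<open>q\<close>, so reflecting brings \<open>x\<close> over to
  the side of \<open>z\<close>.\<close>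

lemma dist_bisector_reflection_le:
  assumes "p \<noteq> q" "dist z p \<le> dist z q" "dist x q \<le> dist x p"
  shows "dist z (bisector_reflection p q x) \<le> dist z x"
proof -
  have "(dist z p)\<^sup>2 - (dist z q)\<^sup>2 \<le> 0" "0 \<le> (dist x p)\<^sup>2 - (dist x q)\<^sup>2"
    using assms by (simp_all add: power_mono)
  then have "((dist x p)\<^sup>2 - (dist x q)\<^sup>2) * ((dist z p)\<^sup>2 - (dist z q)\<^sup>2) / (dist p q)\<^sup>2 \<le> 0"
    by (intro divide_nonpos_nonneg mult_nonneg_nonpos) auto
  then have "(dist z (bisector_reflection p q x))\<^sup>2 \<le> (dist z x)\<^sup>2"
    unfolding dist_bisector_reflection[OF assms(1)] by linarith
  then show ?thesis by (rule power2_le_imp_le) simp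
qed

lemma bisector_reflection_measurable[measurable]:
  "bisector_reflection p q \<in> borel_measurable (borel :: 'a::euclidean_space measure)"
  unfolding bisector_reflection_def by measurable

text \<open>The reflection swapping \<open>p\<close> and \<open>q\<close> moves \<open>ball z r \<inter> ball q s - ball p s\<close>
  into \<open>ball z r \<inter> ball p s - ball q s\<close>, because \<open>z\<close> lies on the side of \<open>p\<close>.\<close>
lemma emeasure_ball_diff_mono_centre:
  fixes z :: "'a::euclidean_space"
  assumes "dist z p \<le> dist z q"
  shows "emeasure lborel (ball z r - ball p s) \<le> emeasure lborel (ball z r - ball q s)"
proof (cases "p = q")
  case False
  let ?\<rho> = "bisector_reflection p q"
  \<comment> \<open>\<open>C\<close> is common to both differences; beyond it they consist of
    \<open>X\<close> and \<open>Y\<close> respectively.\<close>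
  define C where "C = ball z r - (ball p s \<union> ball q s)"
  define X where "X = ball z r \<inter> ball q s - ball p s"
  define Y where "Y = ball z r \<inter> ball p s - ball q s"
  have [measurable]: "C \<in> sets borel" "X \<in> sets borel" "Y \<in> sets borel"
    by (auto simp: C_def X_def Y_def)
  have "?\<rho> x \<in> Y" if "x \<in> X" for x
    using that dist_bisector_reflection_le[OF False assms, of x] dist_bisector_reflection_swap[OF False, of x]
    by (auto simp: X_def Y_def dist_commute)
  then have "X \<subseteq> {x. ?\<rho> x \<in> Y}" by auto
  then have "emeasure lborel X \<le> emeasure lborel {x. ?\<rho> x \<in> Y}"
    by (intro emeasure_mono) auto
  also have "\<dots> = emeasure lborel Y"
    by (rule emeasure_bisector_reflection) simp
  finally have "emeasure lborel X + emeasure lborel C \<le> emeasure lborel Y + emeasure lborel C"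
    by (rule add_right_mono)
  moreover have "ball z r - ball p s = X \<union> C" "X \<inter> C = {}" "ball z r - ball q s = Y \<union> C" "Y \<inter> C = {}"
    by (auto simp: X_def Y_def C_def)
  ultimately show ?thesis by (simp add: plus_emeasure)
qed simp

text \<open>A translation taking \<open>w\<close> to \<open>z\<close> reduces this to a common first
  centre. Applied in both directions to equal distances, it shows that the volume depends on the
  distance of the centres alone.\<close>

lemma emeasure_ball_diff_mono:
  fixes z w :: "'a::euclidean_space"
  assumes "dist z p \<le> dist w q"
  shows "emeasure lborel (ball z r - ball p s) \<le> emeasure lborel (ball w r - ball q s)"
proof -
  have "emeasure lborel (ball w r - ball q s) = emeasure lborel {x. w - z + x \<in> ball w r - ball q s}"
    by (rule emeasure_lborel_translate[symmetric]) auto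
  also have "{x. w - z + x \<in> ball w r - ball q s} = ball z r - ball (q - w + z) s"
    by (auto simp: dist_norm algebra_simps)
  finally show ?thesis
    using emeasure_ball_diff_mono_centre[of z p "q - w + z" r s] assms
    by (simp add: dist_norm norm_minus_commute algebra_simps)
qed

subsection \<open>Volume lost along a curve\<close>

text \<open>The term \<open>s\<^sup>2\<close> in the radius cancels the one from expanding the
  square. Geometrically, the bounding spheres all meet the hyperplane through 0 orthogonal to
  \<open>u\<close> in the same set.\<close>

lemma mem_ball_axis_iff:
  assumes "norm u = 1" "0 \<le> c"
  shows "x \<in> ball (s *\<^sub>R u) (sqrt (c + s\<^sup>2)) \<longleftrightarrow> (norm x)\<^sup>2 - 2 * s * (x \<bullet> u) < c"
proof -
  have "u \<bullet> u = 1" using assms by (simp add: norm_eq_1)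
  then have "(dist (s *\<^sub>R u) x)\<^sup>2 = (norm x)\<^sup>2 - 2 * s * (x \<bullet> u) + s\<^sup>2"
    unfolding dist_norm power2_norm_eq_inner
    by (simp add: inner_diff_left inner_diff_right inner_commute power2_eq_square algebra_simps)
  moreover have "x \<in> ball (s *\<^sub>R u) (sqrt (c + s\<^sup>2)) \<longleftrightarrow> (dist (s *\<^sub>R u) x)\<^sup>2 < c + s\<^sup>2"
    using real_less_rsqrt real_sqrt_less_iff[of "(dist (s *\<^sub>R u) x)\<^sup>2" "c + s\<^sup>2"] by auto
  ultimately show ?thesis by auto
qed

text \<open>With the radius \<open>sqrt (c + s\<^sup>2)\<close> at time \<open>s\<close>, membership on the axis is affine in \<open>s\<close>.
  Hence a point of the ball at time \<open>s m\<close> that is lost at the next step was never lost before,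
  and the losses along the line add up exactly.\<close>
lemma emeasure_ball_chain_loss_le:
  fixes p :: "nat \<Rightarrow> 'a::euclidean_space" and s :: "nat \<Rightarrow> real" and u :: 'a
  assumes u: "norm u = 1" and c: "0 \<le> c" and s0: "s 0 = 0"
    and step: "\<And>i. i < m \<Longrightarrow> dist (p i) (p (Suc i)) \<le> s (Suc i) - s i"
  shows "emeasure lborel (ball (p 0) (sqrt c) - (\<Inter>i\<le>m. ball (p i) (sqrt (c + (s i)\<^sup>2))))
    \<le> emeasure lborel (ball 0 (sqrt c) - ball (s m *\<^sub>R u) (sqrt (c + (s m)\<^sup>2)))"
  using step
proof (induction m)
  case 0
  then show ?case by (simp add: s0)
next
  case (Suc m)
  define B where "B i = ball (p i) (sqrt (c + (s i)\<^sup>2))" for i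
  define B' where "B' i = ball (s i *\<^sub>R u) (sqrt (c + (s i)\<^sup>2))" for i
  define E where "E i = ball 0 (sqrt c) - B' i" for i
  have meas[measurable]: "B i \<in> sets borel" "B' i \<in> sets borel" "E i \<in> sets borel" for i
    by (auto simp: B_def B'_def E_def)
  have inc: "s i \<le> s (Suc i)" if "i \<le> m" for i
    using Suc.prems[of i] that zero_le_dist[of "p i" "p (Suc i)"] by linarith
  have "0 \<le> s i" if "i \<le> Suc m" for i
    using that
  proof (induction i)
    case (Suc i)
    then show ?case using inc[of i] by simp
  qed (simp add: s0)
  then have sm: "0 \<le> s m" by simp
  have B'_iff: "x \<in> B' i \<longleftrightarrow> (norm x)\<^sup>2 - 2 * s i * (x \<bullet> u) < c" for x i
    unfolding B'_def by (rule mem_ball_axis_iff[OF u c])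
  have B0_iff: "norm x < sqrt c \<longleftrightarrow> (norm x)\<^sup>2 < c" for x :: 'a
    using mem_ball_axis_iff[OF u c, of x 0] by simp
  have mult: "s (Suc m) * a \<le> s m * a" if "a \<le> 0" for a
    using inc[of m] that by (simp add: mult_right_mono_neg)
  have disj: "E m \<inter> (B' m - B' (Suc m)) = {}"
    by (auto simp: E_def)
  have sub: "E m \<union> (B' m - B' (Suc m)) \<subseteq> E (Suc m)"
  proof
    fix x assume x: "x \<in> E m \<union> (B' m - B' (Suc m))"
    define a where "a = x \<bullet> u"
    \<comment> \<open>A point is lost when the affine function
      \<open>(norm x)\<^sup>2 - 2 * s * a\<close> of \<open>s\<close> reaches \<open>c\<close> from
      below, so it cannot be decreasing. Then a point inside at \<open>s m\<close> was inside at 0,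
      and a point already lost stays lost.\<close>
    have "a \<le> 0"
    proof (rule ccontr)
      assume "\<not> a \<le> 0"
      then have "0 \<le> s m * a" "s m * a \<le> s (Suc m) * a" using sm inc[of m] by (auto intro: mult_right_mono)
      then show False using x by (auto simp: E_def B'_iff B0_iff a_def[symmetric])
    qed
    then have "s m * a \<le> 0" "s (Suc m) * a \<le> s m * a"
      using sm mult by (auto simp: mult_nonneg_nonpos)
    then show "x \<in> E (Suc m)"
      using x by (auto simp: E_def B'_iff B0_iff a_def[symmetric])
  qed
  \<comment> \<open>A point in the balls up to index \<open>m\<close> that misses the next one lies
    in \<open>B m - B (Suc m)\<close>.\<close>
  have "emeasure lborel (B 0 - (\<Inter>i\<le>Suc m. B i))
    \<le> emeasure lborel ((B 0 - (\<Inter>i\<le>m. B i)) \<union> (B m - B (Suc m)))"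
    by (intro emeasure_mono) (auto simp: le_Suc_eq)
  also have "\<dots> \<le> emeasure lborel (B 0 - (\<Inter>i\<le>m. B i)) + emeasure lborel (B m - B (Suc m))"
    by (intro emeasure_subadditive) auto
  also have "\<dots> \<le> emeasure lborel (E m) + emeasure lborel (B' m - B' (Suc m))"
  proof (rule add_mono)
    show "emeasure lborel (B 0 - (\<Inter>i\<le>m. B i)) \<le> emeasure lborel (E m)"
      using Suc.IH Suc.prems by (simp add: B_def B'_def E_def s0)
    \<comment> \<open>On the line the step has the greatest length allowed to the chain.\<close>
    have "dist (s m *\<^sub>R u) (s (Suc m) *\<^sub>R u) = s (Suc m) - s m"
      using u inc[of m] by (simp add: dist_norm flip: scaleR_diff_left)
    then show "emeasure lborel (B m - B (Suc m)) \<le> emeasure lborel (B' m - B' (Suc m))"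
      unfolding B_def B'_def using Suc.prems[of m] by (intro emeasure_ball_diff_mono) simp
  qed
  also have "\<dots> = emeasure lborel (E m \<union> (B' m - B' (Suc m)))"
    using disj by (intro plus_emeasure) auto
  also have "\<dots> \<le> emeasure lborel (E (Suc m))"
    using sub by (intro emeasure_mono) auto
  finally show ?case by (simp add: B_def B'_def E_def s0)
qed

text \<open>\<open>H\<close> collects the points lying in the balls at all dyadic fractions of
  \<open>L\<close>. The chain bound holds on each dyadic grid, and refining the grid makes the lost
  sets increase, so it passes to the limit. Other times are limits of dyadic ones, where only a weak
  inequality survives; the end \<open>L\<close> is on every grid and keeps the strict one.\<close>

lemma emeasure_curve_loss_le:
  fixes p :: "real \<Rightarrow> 'a::euclidean_space" and u :: 'a
  assumes u: "norm u = 1" and c: "0 \<le> c" and L: "0 \<le> L"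
    and lip: "\<And>a b. \<lbrakk>0 \<le> a; a \<le> b; b \<le> L\<rbrakk> \<Longrightarrow> dist (p a) (p b) \<le> b - a"
  obtains H where "H \<in> sets borel"
    "emeasure lborel (ball (p 0) (sqrt c) - H)
      \<le> emeasure lborel (ball 0 (sqrt c) - ball (L *\<^sub>R u) (sqrt (c + L\<^sup>2)))"
    "\<And>x s. \<lbrakk>x \<in> H; 0 \<le> s; s \<le> L\<rbrakk> \<Longrightarrow> dist (p s) x \<le> sqrt (c + s\<^sup>2)"
    "H \<subseteq> ball (p L) (sqrt (c + L\<^sup>2))"
proof
  define s where "s k i = L * (real i / 2 ^ k)" for k i :: nat
  define H' where "H' k = (\<Inter>i\<le>2 ^ k. ball (p (s k i)) (sqrt (c + (s k i)\<^sup>2)))" for k :: nat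
  define H where "H = (\<Inter>k. H' k)"
  have meas[measurable]: "H' k \<in> sets borel" for k by (auto simp: H'_def)
  show "H \<in> sets borel" by (auto simp: H_def)
  have s_mono: "s k i \<le> s k j" if "i \<le> j" for k i j
    using L that by (auto simp: s_def intro!: mult_left_mono divide_right_mono)
  have s_nonneg: "0 \<le> s k i" for k i using L by (simp add: s_def)
  have s_end: "s k (2 ^ k) = L" for k by (simp add: s_def)
  have s_refine: "s (Suc k) (2 * i) = s k i" for k i by (simp add: s_def)
  have H'_mono: "H' (Suc k) \<subseteq> H' k" for k
  proof
    fix x assume x: "x \<in> H' (Suc k)"
    show "x \<in> H' k" unfolding H'_def
    proof (intro INT_I)
      fix i :: nat assume "i \<in> {..2 ^ k}"
      then have "2 * i \<in> {..2 ^ Suc k}" by simp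
      then have "x \<in> ball (p (s (Suc k) (2 * i))) (sqrt (c + (s (Suc k) (2 * i))\<^sup>2))"
        using x unfolding H'_def by blast
      then show "x \<in> ball (p (s k i)) (sqrt (c + (s k i)\<^sup>2))"
        by (simp only: s_refine)
    qed
  qed
  have bound: "emeasure lborel (ball (p 0) (sqrt c) - H' k)
      \<le> emeasure lborel (ball 0 (sqrt c) - ball (L *\<^sub>R u) (sqrt (c + L\<^sup>2)))" for k
  proof -
    have "dist (p (s k i)) (p (s k (Suc i))) \<le> s k (Suc i) - s k i" if "i < 2 ^ k" for i
      using that s_mono[of "Suc i" "2 ^ k" k] by (intro lip s_nonneg s_mono) (auto simp: s_end)
    then show ?thesis
      using emeasure_ball_chain_loss_le[OF u c, of "s k" "2 ^ k" "\<lambda>i. p (s k i)"]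
      by (simp add: H'_def s_end) (simp add: s_def)
  qed
  have "ball (p 0) (sqrt c) - H = (\<Union>k. ball (p 0) (sqrt c) - H' k)"
    by (auto simp: H_def)
  also have "emeasure lborel \<dots> = (SUP k. emeasure lborel (ball (p 0) (sqrt c) - H' k))"
    using H'_mono by (intro SUP_emeasure_incseq[symmetric]) (auto intro!: incseq_SucI)
  also have "\<dots> \<le> emeasure lborel (ball 0 (sqrt c) - ball (L *\<^sub>R u) (sqrt (c + L\<^sup>2)))"
    by (rule SUP_least) (rule bound)
  finally show "emeasure lborel (ball (p 0) (sqrt c) - H)
      \<le> emeasure lborel (ball 0 (sqrt c) - ball (L *\<^sub>R u) (sqrt (c + L\<^sup>2)))" .
  have "H \<subseteq> H' 0" by (auto simp: H_def)
  also have "\<dots> \<subseteq> ball (p (s 0 1)) (sqrt (c + (s 0 1)\<^sup>2))"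
    unfolding H'_def by (rule INT_lower) simp
  finally show "H \<subseteq> ball (p L) (sqrt (c + L\<^sup>2))" by (simp add: s_def)
  fix x r assume x: "x \<in> H" and r: "0 \<le> r" "r \<le> L"
  have approx: "dist (p r) x \<le> sqrt (c + r\<^sup>2) + L / 2 ^ k" for k :: nat
  proof -
    \<comment> \<open>Index of the last grid time not after \<open>r\<close>; for
      \<open>L = 0\<close> the division by zero gives 0, which is right since then
      \<open>r = 0\<close>.\<close>
    define i where "i = nat \<lfloor>2 ^ k * r / L\<rfloor>"
    have i: "s k i \<le> r \<and> r - s k i \<le> L / 2 ^ k \<and> i \<le> 2 ^ k"
    proof (cases "L = 0")
      case False
      define y where "y = 2 ^ k * r / L"
      have y: "0 \<le> y" "y \<le> 2 ^ k" "r = L * (y / 2 ^ k)"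
        using L r False by (auto simp: y_def field_simps)
      have "real i = of_int \<lfloor>y\<rfloor>"
        using y(1) unfolding i_def y_def[symmetric] by simp
      then have iy: "real i \<le> y" "y - real i \<le> 1" by linarith+
      have "real i \<le> 2 ^ k" using iy y(2) by linarith
      then have "i \<le> 2 ^ k" by simp
      moreover have "r - s k i = L / 2 ^ k * (y - real i)"
        unfolding s_def y(3) by (simp add: field_simps)
      moreover have "0 \<le> L / 2 ^ k * (y - real i)" using L iy by simp
      moreover have "L / 2 ^ k * (y - real i) \<le> L / 2 ^ k * 1"
        using L iy by (intro mult_left_mono) auto
      ultimately show ?thesis by auto
    qed (use r in \<open>simp add: s_def i_def\<close>)
    then have i: "s k i \<le> r" "r - s k i \<le> L / 2 ^ k" "i \<le> 2 ^ k" by auto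
    have "dist (p (s k i)) x < sqrt (c + (s k i)\<^sup>2)"
      using x i(3) by (auto simp: H_def H'_def)
    also have "\<dots> \<le> sqrt (c + r\<^sup>2)"
      using i(1) s_nonneg[of k i] by (simp add: power_mono)
    finally have "dist (p (s k i)) x < sqrt (c + r\<^sup>2)" .
    moreover have "dist (p (s k i)) (p r) \<le> r - s k i"
      using i(1) r s_nonneg by (intro lip) auto
    ultimately show ?thesis
      using dist_triangle[of "p r" x "p (s k i)"] i(2) by (simp add: dist_commute)
  qed
  have "(\<lambda>k. sqrt (c + r\<^sup>2) + L / 2 ^ k) \<longlonglongrightarrow> sqrt (c + r\<^sup>2) + 0"
    by (intro tendsto_add tendsto_const LIMSEQ_divide_realpow_zero) simp
  then show "dist (p r) x \<le> sqrt (c + r\<^sup>2)"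
    using approx by (intro LIMSEQ_le_const) auto
qed

text \<open>The curve is started at its midpoint \<open>q L\<close> and run in both directions; for the line,
  the two lost sets are disjoint, so the union bound is an equality there.\<close>
lemma emeasure_inter_balls_curve_ge:
  fixes q :: "real \<Rightarrow> 'a::euclidean_space" and u :: 'a
  assumes u: "norm u = 1" and L: "0 < L" "L < 1"
    and lip: "\<And>a b. \<lbrakk>0 \<le> a; a \<le> b; b \<le> 2 * L\<rbrakk> \<Longrightarrow> dist (q a) (q b) \<le> b - a"
    and W: "{x. \<forall>s\<in>{0..2 * L}. dist (q s) x < 1} \<in> sets borel"
  shows "emeasure lborel (ball (L *\<^sub>R u) 1 \<inter> ball (- L *\<^sub>R u) 1) \<le> emeasure lborel {x. \<forall>s\<in>{0..2 * L}. dist (q s) x < 1}"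
proof -
  let ?W = "{x. \<forall>s\<in>{0..2 * L}. dist (q s) x < 1}"
  \<comment> \<open>This choice makes the radius exactly 1 at both ends of the curve and less than 1
    strictly between them.\<close>
  define c where "c = 1 - L\<^sup>2"
  have cL: "c + L\<^sup>2 = 1" by (simp add: c_def)
  have "L\<^sup>2 < 1" using L by (simp add: power_less_one_iff)
  then have c: "0 \<le> c" by (simp add: c_def)
  have small: "sqrt (c + s\<^sup>2) < 1" if "0 \<le> s" "s < L" for s
    using that L by (simp add: c_def power_strict_mono)
  have lipH: "dist (q (L + a)) (q (L + b)) \<le> b - a" if "0 \<le> a" "a \<le> b" "b \<le> L" for a b
    using that L lip[of "L + a" "L + b"] by (simp add: dist_commute)
  obtain H where H0: "H \<in> sets borel"
    "emeasure lborel (ball (q (L + 0)) (sqrt c) - H)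
      \<le> emeasure lborel (ball 0 (sqrt c) - ball (L *\<^sub>R u) (sqrt (c + L\<^sup>2)))"
    "\<And>x s. \<lbrakk>x \<in> H; 0 \<le> s; s \<le> L\<rbrakk> \<Longrightarrow> dist (q (L + s)) x \<le> sqrt (c + s\<^sup>2)"
    "H \<subseteq> ball (q (L + L)) (sqrt (c + L\<^sup>2))"
    by (rule emeasure_curve_loss_le[OF u c less_imp_le[OF L(1)], of "\<lambda>s. q (L + s)"]) (rule lipH that; assumption)+
  have H: "H \<in> sets borel"
    "emeasure lborel (ball (q L) (sqrt c) - H) \<le> emeasure lborel (ball 0 (sqrt c) - ball (L *\<^sub>R u) 1)"
    "\<And>x s. \<lbrakk>x \<in> H; 0 \<le> s; s \<le> L\<rbrakk> \<Longrightarrow> dist (q (L + s)) x \<le> sqrt (c + s\<^sup>2)"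
    "H \<subseteq> ball (q (L + L)) 1"
    using H0 by (simp_all add: cL)
  have lipK: "dist (q (L - a)) (q (L - b)) \<le> b - a" if "0 \<le> a" "a \<le> b" "b \<le> L" for a b
    using that L lip[of "L - b" "L - a"] by (simp add: dist_commute)
  obtain K where K0: "K \<in> sets borel"
    "emeasure lborel (ball (q (L - 0)) (sqrt c) - K)
      \<le> emeasure lborel (ball 0 (sqrt c) - ball (L *\<^sub>R u) (sqrt (c + L\<^sup>2)))"
    "\<And>x s. \<lbrakk>x \<in> K; 0 \<le> s; s \<le> L\<rbrakk> \<Longrightarrow> dist (q (L - s)) x \<le> sqrt (c + s\<^sup>2)"
    "K \<subseteq> ball (q (L - L)) (sqrt (c + L\<^sup>2))"
    by (rule emeasure_curve_loss_le[OF u c less_imp_le[OF L(1)], of "\<lambda>s. q (L - s)"]) (rule lipK that; assumption)+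
  have K: "K \<in> sets borel"
    "emeasure lborel (ball (q L) (sqrt c) - K) \<le> emeasure lborel (ball 0 (sqrt c) - ball (L *\<^sub>R u) 1)"
    "\<And>x s. \<lbrakk>x \<in> K; 0 \<le> s; s \<le> L\<rbrakk> \<Longrightarrow> dist (q (L - s)) x \<le> sqrt (c + s\<^sup>2)"
    "K \<subseteq> ball (q 0) 1"
    using K0 by (simp_all add: cL)
  \<comment> \<open>At inner times the weak bound suffices, as the radius is below 1. At the two
    ends the radius is 1 and the strict containments in the open end balls are used.\<close>
  have sub: "H \<inter> K \<subseteq> ?W"
  proof clarify
    fix x s assume x: "x \<in> H" "x \<in> K" and s: "s \<in> {0..2 * L}"
    consider "s = 0" | "s = 2 * L" | "0 < s" "s \<le> L" | "L < s" "s < 2 * L"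
      using s by fastforce
    then show "dist (q s) x < 1"
    proof cases
      case 3
      then show ?thesis using le_less_trans[OF K(3)[OF x(2), of "L - s"] small[of "L - s"]] by simp
    next
      case 4
      then show ?thesis using le_less_trans[OF H(3)[OF x(1), of "s - L"] small[of "s - L"]] by simp
    next
      case 2
      have "x \<in> ball (q (L + L)) 1" using x(1) H(4) by blast
      then show ?thesis by (simp add: 2)
    qed (use x K(4) in auto)
  qed
  let ?B = "ball (0::'a) (sqrt c)" and ?P = "ball (L *\<^sub>R u) 1" and ?N = "ball (- L *\<^sub>R u) 1"
  have P_iff: "x \<in> ?P \<longleftrightarrow> (norm x)\<^sup>2 - 2 * L * (x \<bullet> u) < c" for x
    using mem_ball_axis_iff[OF u c, of x L] by (simp add: cL)
  have N_iff: "x \<in> ?N \<longleftrightarrow> (norm x)\<^sup>2 + 2 * L * (x \<bullet> u) < c" for x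
    using mem_ball_axis_iff[OF u c, of x "- L"] by (simp add: cL)
  have B_iff: "x \<in> ?B \<longleftrightarrow> (norm x)\<^sup>2 < c" for x
    using mem_ball_axis_iff[OF u c, of x 0] by simp
  \<comment> \<open>The condition for \<open>?B\<close> is the average of those for
    \<open>?P\<close> and \<open>?N\<close>: both together imply it, and it implies at least one of
    them. The latter makes the two losses disjoint.\<close>
  have PN: "?P \<inter> ?N \<subseteq> ?B"
  proof
    fix x assume "x \<in> ?P \<inter> ?N"
    then have "(norm x)\<^sup>2 - 2 * L * (x \<bullet> u) < c" "(norm x)\<^sup>2 + 2 * L * (x \<bullet> u) < c"
      by (simp_all only: Int_iff P_iff N_iff)
    then show "x \<in> ?B" unfolding B_iff by linarith
  qed
  have BPN: "?B \<subseteq> ?P \<union> ?N"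
  proof
    fix x assume "x \<in> ?B"
    then have "(norm x)\<^sup>2 < c" by (simp only: B_iff)
    then show "x \<in> ?P \<union> ?N" unfolding Un_iff P_iff N_iff by linarith
  qed
  have B_eq: "?B = (?P \<inter> ?N) \<union> ((?B - ?P) \<union> (?B - ?N))" "(?P \<inter> ?N) \<inter> ((?B - ?P) \<union> (?B - ?N)) = {}"
    "(?B - ?P) \<inter> (?B - ?N) = {}"
    using PN BPN by blast+
  let ?D = "emeasure lborel (?B - ?P)"
  have D: "emeasure lborel (?B - ?N) = ?D"
    using emeasure_ball_diff_mono[of 0 "L *\<^sub>R u" 0 "- L *\<^sub>R u" "sqrt c" 1]
      emeasure_ball_diff_mono[of 0 "- L *\<^sub>R u" 0 "L *\<^sub>R u" "sqrt c" 1]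
    by (simp add: antisym)
  have "emeasure lborel ?B = emeasure lborel (?P \<inter> ?N) + (?D + ?D)"
  proof -
    have "emeasure lborel ((?P \<inter> ?N) \<union> ((?B - ?P) \<union> (?B - ?N)))
      = emeasure lborel (?P \<inter> ?N) + (?D + emeasure lborel (?B - ?N))"
      using B_eq(2,3) by (subst plus_emeasure[symmetric] | simp)+
    then show ?thesis using B_eq(1) D by simp
  qed
  moreover have "emeasure lborel ?B \<le> emeasure lborel (H \<inter> K) + (?D + ?D)"
  proof -
    let ?A = "ball (q L) (sqrt c)"
    have "emeasure lborel ?B = emeasure lborel {x. - q L + x \<in> ?B}"
      by (rule emeasure_lborel_translate[symmetric]) simp
    also have "{x. - q L + x \<in> ?B} = ?A"
      by (auto simp: dist_norm norm_minus_commute)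
    also have "emeasure lborel ?A \<le> emeasure lborel ((H \<inter> K) \<union> ((?A - H) \<union> (?A - K)))"
      using H(1) K(1) by (intro emeasure_mono) auto
    also have "\<dots> \<le> emeasure lborel (H \<inter> K) + (emeasure lborel (?A - H) + emeasure lborel (?A - K))"
      using H(1) K(1) by (intro order_trans[OF emeasure_subadditive] add_left_mono emeasure_subadditive) auto
    also have "\<dots> \<le> emeasure lborel (H \<inter> K) + (?D + ?D)"
      using H(2) K(2) by (intro add_mono order_refl) auto
    finally show ?thesis .
  qed
  \<comment> \<open>Finiteness allows the two losses to be cancelled.\<close>
  moreover have "?D \<noteq> top"
  proof -
    have "?D \<le> emeasure lborel ?B" by (intro emeasure_mono) auto
    then show ?thesis using emeasure_lborel_ball_finite[of "0::'a" "sqrt c"] by (auto simp: top_unique)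
  qed
  ultimately have "emeasure lborel (?P \<inter> ?N) \<le> emeasure lborel (H \<inter> K)"
    by (simp add: ennreal_add_left_cancel_le add.commute[of _ "?D + ?D"])
  also have "\<dots> \<le> emeasure lborel ?W"
    using sub W by (intro emeasure_mono) auto
  finally show ?thesis .
qed

subsection \<open>Escape times\<close>

text \<open>Appending \<open>a\<close> and \<open>b\<close> to a partition of \<open>{0..a}\<close>
  gives a partition of \<open>{0..b}\<close>. Hence the length up to \<open>a\<close> plus the chord
  is at most the length up to \<open>b\<close>, and these lengths are \<open>a\<close> and
  \<open>b\<close>.\<close>

lemma arc_path_lipschitz:
  assumes g: "arc_path g" and ab: "0 \<le> a" "a \<le> b"
  shows "dist (g a) (g b) \<le> b - a"
proof (cases "b = 0")
  case False
  then have b: "0 < b" using ab by simp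
  define d where "d = norm (g b - g a)"
  define S where "S ts = (\<Sum>i<length ts - 1. norm (g (ts ! Suc i) - g (ts ! i)))" for ts
  have S_le: "S ts + d \<le> b" if ts: "sorted ts" "set ts \<subseteq> {0..a}" for ts
  proof -
    have "S ts + d \<le> S (ts @ [a, b])"
    proof -
      have "S (ts @ [a, b]) = (\<Sum>i<length ts. norm (g ((ts @ [a, b]) ! Suc i) - g ((ts @ [a, b]) ! i))) + d"
        by (simp add: S_def d_def nth_append)
      moreover have "S ts = (\<Sum>i<length ts - 1. norm (g ((ts @ [a, b]) ! Suc i) - g ((ts @ [a, b]) ! i)))"
        unfolding S_def by (intro sum.cong) (auto simp: nth_append)
      moreover have "\<dots> \<le> (\<Sum>i<length ts. norm (g ((ts @ [a, b]) ! Suc i) - g ((ts @ [a, b]) ! i)))"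
        by (intro sum_mono2) auto
      ultimately show ?thesis by linarith
    qed
    moreover have "ennreal (S (ts @ [a, b])) \<le> curve_length g 0 b"
      unfolding curve_length_def S_def
      by (rule SUP_upper) (use ts ab in \<open>auto simp: sorted_append\<close>)
    ultimately show ?thesis
      using g b by (simp add: arc_path_def)
  qed
  have "d \<le> b" using S_le[of "[]"] by (simp add: S_def)
  have "a \<le> b - d"
  \<comment> \<open>The length is prescribed at positive times only; at 0 the empty partition has
    already given the bound.\<close>
  proof (cases "a = 0")
    case False
    have "ennreal a = curve_length g 0 a" using g False ab by (simp add: arc_path_def)
    also have "\<dots> \<le> ennreal (b - d)"
      unfolding curve_length_def S_def[symmetric]
      by (rule SUP_least) (use S_le in \<open>fastforce intro!: ennreal_leI simp: le_diff_eq\<close>)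
    finally show ?thesis using \<open>d \<le> b\<close> by simp
  qed (use \<open>d \<le> b\<close> in simp)
  then show ?thesis by (simp add: d_def dist_norm norm_minus_commute)
qed (use ab in simp)

definition survivors :: "(real \<Rightarrow> 'a::real_normed_vector) \<Rightarrow> real \<Rightarrow> 'a set" where
  "survivors g t = {x. \<forall>s\<in>{0..t}. norm (x + g s) < 1}"

text \<open>By continuity the set \<open>A\<close> of times outside the open ball is closed, so a
  nonempty \<open>A\<close> contains its infimum. This makes the inequality strict.\<close>

lemma less_escape_time_iff:
  assumes g: "continuous_on {0..} g" and t: "0 \<le> t"
  shows "ennreal t < escape_time g x \<longleftrightarrow> x \<in> survivors g t"
proof -
  define A where "A = {s. 0 \<le> s \<and> 1 \<le> norm (x + g s)}"
  have esc: "escape_time g x = (INF s\<in>A. ennreal s)"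
    by (simp add: escape_time_def A_def not_less)
  show ?thesis
  proof
    assume less: "ennreal t < escape_time g x"
    show "x \<in> survivors g t"
      unfolding survivors_def
    proof (clarify, rule ccontr)
      fix s assume s: "s \<in> {0..t}" "\<not> norm (x + g s) < 1"
      then have "escape_time g x \<le> ennreal s"
        unfolding esc by (intro INF_lower) (auto simp: A_def)
      also have "\<dots> \<le> ennreal t" using s by (intro ennreal_leI) simp
      finally show False using less by simp
    qed
  next
    assume x: "x \<in> survivors g t"
    show "ennreal t < escape_time g x"
    proof (cases "A = {}")
      case False
      have "closed ({0..} \<inter> (\<lambda>s. norm (x + g s)) -` {1..})"
        by (rule continuous_closed_preimage) (auto intro!: continuous_intros g)
      also have "{0..} \<inter> (\<lambda>s. norm (x + g s)) -` {1..} = A" by (auto simp: A_def)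
      finally have "closed A" .
      moreover have bdd: "bdd_below A" by (auto simp: A_def bdd_below_def)
      ultimately have "Inf A \<in> A" using False by (intro closed_contains_Inf)
      then have "t < Inf A"
        using x t by (force simp: A_def survivors_def not_le[symmetric])
      then have "ennreal t < ennreal (Inf A)" using t by (simp add: ennreal_lessI)
      also have "\<dots> \<le> escape_time g x"
        unfolding esc using bdd by (intro INF_greatest ennreal_leI cInf_lower)
      finally show ?thesis .
    qed (simp add: esc)
  qed
qed

text \<open>The complement is the Minkowski sum of the compact curve of centres \<open>- g s\<close>
  and the closed complement of the open unit ball.\<close>

lemma open_survivors:
  assumes g: "continuous_on {0..} g"
  shows "open (survivors g t)"
proof -
  have "compact ((\<lambda>s. - g s) ` {0..t})"
    by (intro compact_continuous_image continuous_intros continuous_on_subset[OF g]) auto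
  then have "closed (\<Union>x\<in>(\<lambda>s. - g s) ` {0..t}. \<Union>y\<in>- ball 0 1. {x + y})"
    by (intro compact_closed_sums) auto
  also have "(\<Union>x\<in>(\<lambda>s. - g s) ` {0..t}. \<Union>y\<in>- ball 0 1. {x + y}) = - survivors g t"
  proof -
    have "x = - g s + y \<longleftrightarrow> y = x + g s" for x y s by (auto simp: algebra_simps)
    then show ?thesis by (auto simp: survivors_def)
  qed
  finally show ?thesis by (simp add: closed_def)
qed

lemma borel_measurable_escape_time:
  assumes g: "continuous_on {0..} g"
  shows "escape_time g \<in> borel_measurable borel"
proof (rule borel_measurableI_greater)
  fix y :: ennreal
  show "{x \<in> space borel. y < escape_time g x} \<in> sets borel"
  proof (cases y)
    case (real t)
    then show ?thesis
      using less_escape_time_iff[OF g] open_survivors[OF g, of t] by simp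
  qed simp
qed

text \<open>Layer-cake formula, by Tonelli. The factor \<open>indicator {0..}\<close> removes
  negative \<open>t\<close>, which \<open>ennreal\<close> would send to 0.\<close>

lemma nn_integral_eq_nn_integral_tail:
  assumes "sigma_finite_measure M" and [measurable]: "f \<in> borel_measurable M"
  shows "(\<integral>\<^sup>+x. f x \<partial>M) = (\<integral>\<^sup>+t. indicator {0..} t * emeasure M {x \<in> space M. ennreal t < f x} \<partial>lborel)"
proof -
  interpret M: sigma_finite_measure M by fact
  interpret P: pair_sigma_finite M "lborel :: real measure" ..
  have layer: "a = (\<integral>\<^sup>+t. indicator {0..} t * indicator {t. ennreal t < a} t \<partial>lborel)" for a :: ennreal
  proof (cases a)
    case (real r)
    then have "(\<integral>\<^sup>+t. indicator {0..} t * indicator {t. ennreal t < a} t \<partial>lborel)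
      = (\<integral>\<^sup>+t. indicator {0..<r} t \<partial>lborel)"
      by (intro nn_integral_cong) (auto simp: indicator_def ennreal_less_iff)
    then show ?thesis using real by simp
  next
    case top
    then have "(\<integral>\<^sup>+t. indicator {0..} t * indicator {t. ennreal t < a} t \<partial>lborel)
      = (\<integral>\<^sup>+t. indicator {0::real..} t \<partial>lborel)"
      by (intro nn_integral_cong) (auto simp: indicator_def)
    also have "\<dots> = top"
    proof (rule ccontr)
      assume "(\<integral>\<^sup>+t. indicator {0::real..} t \<partial>lborel :: ennreal) \<noteq> top"
      then obtain r where r: "0 \<le> r" "emeasure lborel {0::real..} = ennreal r"
        by (cases "emeasure lborel {0::real..}") auto
      have "emeasure lborel {0..r + 1} \<le> emeasure lborel {0::real..}" by (intro emeasure_mono) auto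
      then show False using r by simp
    qed
    finally show ?thesis using top by simp
  qed
  have "(\<integral>\<^sup>+x. f x \<partial>M) = (\<integral>\<^sup>+x. (\<integral>\<^sup>+t. indicator {0..} t * indicator {x \<in> space M. ennreal t < f x} x \<partial>lborel) \<partial>M)"
    by (rule nn_integral_cong) (subst layer, auto intro!: nn_integral_cong simp: indicator_def)
  also have "\<dots> = (\<integral>\<^sup>+t. (\<integral>\<^sup>+x. indicator {0..} t * indicator {x \<in> space M. ennreal t < f x} x \<partial>M) \<partial>lborel)"
    by (rule P.Fubini'[symmetric]) (measurable; simp add: indicator_def)
  also have "\<dots> = (\<integral>\<^sup>+t. indicator {0..} t * emeasure M {x \<in> space M. ennreal t < f x} \<partial>lborel)"
    by (rule nn_integral_cong) (subst nn_integral_cmult_indicator, auto)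
  finally show ?thesis .
qed

lemma emeasure_survivors_line_le:
  fixes g :: "real \<Rightarrow> 'a::euclidean_space" and u :: 'a
  assumes g: "arc_path g" and u: "norm u = 1" and t: "0 \<le> t"
  shows "emeasure lborel (survivors (\<lambda>s. s *\<^sub>R u) t) \<le> emeasure lborel (survivors g t)"
proof -
  have cont: "continuous_on {0..} g" and g0: "g 0 = 0" using g by (auto simp: arc_path_def)
  consider "t = 0" | "2 \<le> t" | "0 < t" "t < 2" using t by linarith
  then show ?thesis
  proof cases
    case 1
    then show ?thesis by (simp add: survivors_def g0)
  next
    case 2
    \<comment> \<open>Two points at distance 2 cannot both lie in the open unit ball.\<close>
    have "\<not> (norm x < 1 \<and> norm (x + 2 *\<^sub>R u) < 1)" for x
      using norm_triangle_ineq4[of "x + 2 *\<^sub>R u" x] u by simp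
    then have "survivors (\<lambda>s. s *\<^sub>R u) t = {}"
      using 2 by (force simp: survivors_def)
    then show ?thesis by simp
  next
    case 3
    define L where "L = t / 2"
    have L: "0 < L" "L < 1" "2 * L = t" using 3 by (auto simp: L_def)
    have eq: "survivors g t = {x. \<forall>s\<in>{0..2 * L}. dist (- g s) x < 1}"
    proof -
      have "- g s - x = - (x + g s)" for s x by simp
      then have "dist (- g s) x = norm (x + g s)" for s x
        by (simp only: dist_norm norm_minus_cancel)
      then show ?thesis by (simp add: survivors_def L(3))
    qed
    let ?P = "ball (L *\<^sub>R u) 1" and ?N = "ball (- L *\<^sub>R u) 1"
    \<comment> \<open>Keeping only the times 0 and \<open>t\<close> bounds the survivors by a lens
      of two balls; the shift by \<open>L *\<^sub>R u\<close> makes their centres symmetric about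
      0.\<close>
    have "survivors (\<lambda>s. s *\<^sub>R u) t \<subseteq> {x. L *\<^sub>R u + x \<in> ?P \<inter> ?N}"
    proof
      fix x assume "x \<in> survivors (\<lambda>s. s *\<^sub>R u) t"
      then have "norm (x + 0 *\<^sub>R u) < 1" "norm (x + t *\<^sub>R u) < 1"
        using t unfolding survivors_def by fastforce+
      moreover have "dist (- L *\<^sub>R u) (L *\<^sub>R u + x) = norm (x + t *\<^sub>R u)"
        unfolding dist_norm L(3)[symmetric]
        by (subst norm_minus_cancel[symmetric]) (simp add: algebra_simps flip: scaleR_2)
      ultimately show "x \<in> {x. L *\<^sub>R u + x \<in> ?P \<inter> ?N}"
        by (simp add: dist_norm)
    qed
    then have "emeasure lborel (survivors (\<lambda>s. s *\<^sub>R u) t) \<le> emeasure lborel {x. L *\<^sub>R u + x \<in> ?P \<inter> ?N}"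
      by (intro emeasure_mono) auto
    also have "\<dots> = emeasure lborel (?P \<inter> ?N)"
      by (rule emeasure_lborel_translate) auto
    also have "\<dots> \<le> emeasure lborel (survivors g t)"
      unfolding eq
    proof (rule emeasure_inter_balls_curve_ge[OF u L(1,2)])
      show "dist (- g a) (- g b) \<le> b - a" if "0 \<le> a" "a \<le> b" "b \<le> 2 * L" for a b
        using arc_path_lipschitz[OF g that(1,2)] by (simp add: dist_minus)
      show "{x. \<forall>s\<in>{0..2 * L}. dist (- g s) x < 1} \<in> sets borel"
        using open_survivors[OF cont, of t] by (simp add: eq)
    qed
    finally show ?thesis .
  qed
qed

lemma expected_escape_eq_tail:
  fixes g :: "real \<Rightarrow> 'a::euclidean_space"
  assumes g: "continuous_on {0..} g" "g 0 = 0"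
  shows "expected_escape g
    = (\<integral>\<^sup>+t. indicator {0..} t * emeasure lborel (survivors g t) \<partial>lborel) / emeasure lborel (cball (0::'a) 1)"
proof -
  have "sigma_finite_measure (lborel :: 'a measure)" ..
  then have "(\<integral>\<^sup>+x. escape_time g x * indicator (cball 0 1) x \<partial>lborel)
    = (\<integral>\<^sup>+t. indicator {0..} t * emeasure lborel {x \<in> space lborel. ennreal t < escape_time g x * indicator (cball 0 1) x} \<partial>lborel)"
    by (rule nn_integral_eq_nn_integral_tail)
      (auto intro!: borel_measurable_times_ennreal borel_measurable_indicator borel_measurable_escape_time g)
  also have "\<dots> = (\<integral>\<^sup>+t. indicator {0..} t * emeasure lborel (survivors g t) \<partial>lborel)"
  proof (rule nn_integral_cong)
    fix t :: real
    have "{x \<in> space lborel. ennreal t < escape_time g x * indicator (cball 0 1) x} = survivors g t" if "0 \<le> t"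
      using less_escape_time_iff[OF g(1) that] that
      by (force simp: survivors_def g(2) indicator_def)
    then show "indicator {0..} t * emeasure lborel {x \<in> space lborel. ennreal t < escape_time g x * indicator (cball 0 1) x}
      = indicator {0..} t * emeasure lborel (survivors g t)"
      by (simp add: indicator_def)
  qed
  finally show ?thesis
    unfolding expected_escape_def by (subst nn_integral_uniform_measure) (auto simp: borel_measurable_escape_time g(1))
qed

theorem theorem4:
  fixes \<gamma> :: "real \<Rightarrow> 'a::euclidean_space" and u :: 'a
  assumes "arc_path \<gamma>"
    and "norm u = 1"
  shows "expected_escape \<gamma> \<ge> expected_escape (\<lambda>s. s *\<^sub>R u)"
proof -
  have "continuous_on {0..} \<gamma>" "\<gamma> 0 = 0" using assms(1) by (auto simp: arc_path_def)
  moreover have "continuous_on {0..} (\<lambda>s. s *\<^sub>R u)" by (intro continuous_intros)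
  ultimately show ?thesis
    using emeasure_survivors_line_le[OF assms]
    by (auto simp: expected_escape_eq_tail indicator_def intro!: divide_right_mono_ennreal nn_integral_mono)
qed

end
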